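(* Let $R$ be a commutative semiring, $v:R\to M$ an m-valuation and $\varphi:R\to U$ a tangibly surjective supervaluation covering $v$. (a) The elements $[\psi]$ of $C(\varphi)$ correspond uniquely to the MFCE-relations $E$ on $U$ via $[\psi]=[\varphi/E]$; that is, $E\mapsto[\varphi/E]$ is a bijection from the set of MFCE-relations on $U$ onto $C(\varphi)$. (b) Let $\mathrm{MFC}(U)$ denote the set of all MFCE-relations on $U$, ordered by $E_1\le E_2$ iff $E_1\subset E_2$ (as subsets of $U\times U$, i.e. $E_2$ is coarser than $E_1$). Then $E\mapsto[\varphi/E]$ is an anti-isomorphism (an order reversing bijection) from the poset $\mathrm{MFC}(U)$ to the poset $C(\varphi)$.
   Context: All semirings are commutative with $0$ and $1$. A semiring $M$ is bipotent if $a+b\in\{a,b\}$ for all $a,b\in M$; it is totally ordered by $a\le b\iff a+b=b$. A supertropical semiring is a semiring $U$ such that, with $e=e_U:=1+1$: (1) $1+1=1+1+1+1$; (2) $a+a=b+b$ implies $a+b=a+a$; (3) $a+a\ne b+b$ implies $a+b\in\{a,b\}$. Then $e$ is idempotent and $eU$ (the ghost ideal) is a bipotent semiring with unit element $e$. $\mathcal T(U):=U\setminus eU$ is the set of tangible elements. An m-valuation on $R$ is a map $v:R\to M$ into a bipotent semiring $M\neq\{0\}$ with $v(0)=0$, $v(1)=1$, $v(xy)=v(x)v(y)$, $v(x+y)\le v(x)+v(y)$. A supervaluation on $R$ is a map $\varphi:R\to U$ into a supertropical semiring $U$ with $\varphi(0)=0$, $\varphi(1)=1$, $\varphi(ab)=\varphi(a)\varphi(b)$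 and $e\varphi(a+b)\le e\varphi(a)+e\varphi(b)$. A cover of $v:R\to M$ is a supervaluation $\varphi:R\to U$ with $eU=M$ and $e\varphi(a)=v(a)$ for all $a$. $\varphi$ is tangibly surjective if $\varphi(R)\supset\mathcal T(U)$. $\varphi:R\to U$ dominates $\psi:R\to V$ if for all $a,b\in R$: (D1) $\varphi(a)=\varphi(b)\Rightarrow\psi(a)=\psi(b)$; (D2) $e\varphi(a)\le e\varphi(b)\Rightarrow e\psi(a)\le e\psi(b)$; (D3) $\varphi(a)\in eU\Rightarrow\psi(a)\in eV$. Two covers of $v$ are equivalent if each dominates the other; $[\varphi]$ denotes the equivalence class. $\mathrm{Cov}(v)$ is the set of equivalence classes of covers of $v$, with $[\varphi_1]\ge[\varphi_2]$ iff $\varphi_1$ dominates $\varphi_2$. $C(\varphi)$ is the subposet $\{[\psi]\in\mathrm{Cov}(v): [\varphi]\ge[\psi]\}$. An MFCE-relation on $U$ is an equivalence relation $E$ on the set $U$ which is multiplicative ($x_1\sim_E x_2\Rightarrow x_1y\sim_E x_2y$ for all $y\in U$) and fiber conserving ($x_1\sim_E x_2\Rightarrow ex_1=ex_2$). For such $E$ the quotient $U/E$ with $[x]_E+[y]_E=[x+y]_E$, $[x]_E[y]_E=[xy]_E$ is a supertropical semiring, and $ex\mapsto[ex]_E$ is an isomorphism from $eU$ onto the ghost ideal of $U/E$, by which the latter is identified with $M=eU$. The supervaluation $\varphi/E:R\to U/E$ is defined by $(\varphi/E)(a)=[\varphi(a)]_E$. *)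

theory Defs
  imports "HOL-Algebra.QuotRing"
begin

section \<open>Bipotent and supertropical semirings\<close>

text \<open>Semirings are the carrier-based ones of HOL-Algebra; they may be trivial (one = zero).\<close>

locale commutative_semiring = semiring R + comm_monoid R for R (structure)

locale bipotent_semiring = commutative_semiring M for M (structure) +
  assumes bipotent: "\<lbrakk>a \<in> carrier M; b \<in> carrier M\<rbrakk> \<Longrightarrow> a \<oplus> b \<in> {a, b}"

definition semiring_le :: "('a, 'x) ring_scheme \<Rightarrow> 'a \<Rightarrow> 'a \<Rightarrow> bool" where
  "semiring_le M a b \<longleftrightarrow> a \<oplus>\<^bsub>M\<^esub> b = b"

definition ghost_unit :: "('a, 'x) ring_scheme \<Rightarrow> 'a" where
  "ghost_unit U = \<one>\<^bsub>U\<^esub> \<oplus>\<^bsub>U\<^esub> \<one>\<^bsub>U\<^esub>"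

locale supertropical_semiring = commutative_semiring U for U (structure) +
  assumes four_ones: "\<one> \<oplus> \<one> = \<one> \<oplus> \<one> \<oplus> \<one> \<oplus> \<one>"
    and add_same_ghost: "\<lbrakk>a \<in> carrier U; b \<in> carrier U; a \<oplus> a = b \<oplus> b\<rbrakk> \<Longrightarrow> a \<oplus> b = a \<oplus> a"
    and add_diff_ghost: "\<lbrakk>a \<in> carrier U; b \<in> carrier U; a \<oplus> a \<noteq> b \<oplus> b\<rbrakk> \<Longrightarrow> a \<oplus> b \<in> {a, b}"

definition ghost_ideal :: "('a, 'x) ring_scheme \<Rightarrow> 'a set" where
  "ghost_ideal U = (\<lambda>x. ghost_unit U \<otimes>\<^bsub>U\<^esub> x) ` carrier U"

definition ghost_semiring :: "('a, 'x) ring_scheme \<Rightarrow> ('a, 'x) ring_scheme" where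
  "ghost_semiring U = U\<lparr>carrier := ghost_ideal U, one := ghost_unit U\<rparr>"

definition tangibles :: "('a, 'x) ring_scheme \<Rightarrow> 'a set" where
  "tangibles U = carrier U - ghost_ideal U"

section \<open>Valuations, supervaluations and covers\<close>

definition m_valuation :: "'r ring \<Rightarrow> 'm ring \<Rightarrow> ('r \<Rightarrow> 'm) \<Rightarrow> bool" where
  "m_valuation R M v \<longleftrightarrow>
     bipotent_semiring M \<and> carrier M \<noteq> {\<zero>\<^bsub>M\<^esub>} \<and>
     v \<in> carrier R \<rightarrow> carrier M \<and>
     v \<zero>\<^bsub>R\<^esub> = \<zero>\<^bsub>M\<^esub> \<and> v \<one>\<^bsub>R\<^esub> = \<one>\<^bsub>M\<^esub> \<and>
     (\<forall>x \<in> carrier R. \<forall>y \<in> carrier R. v (x \<otimes>\<^bsub>R\<^esub> y) = v x \<otimes>\<^bsub>M\<^esub> v y) \<and>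
     (\<forall>x \<in> carrier R. \<forall>y \<in> carrier R. semiring_le M (v (x \<oplus>\<^bsub>R\<^esub> y)) (v x \<oplus>\<^bsub>M\<^esub> v y))"

definition ghost_map :: "'u ring \<Rightarrow> ('r \<Rightarrow> 'u) \<Rightarrow> 'r \<Rightarrow> 'u" where
  "ghost_map U \<phi> a = ghost_unit U \<otimes>\<^bsub>U\<^esub> \<phi> a"

definition supervaluation :: "'r ring \<Rightarrow> 'u ring \<Rightarrow> ('r \<Rightarrow> 'u) \<Rightarrow> bool" where
  "supervaluation R U \<phi> \<longleftrightarrow>
     supertropical_semiring U \<and>
     \<phi> \<in> carrier R \<rightarrow> carrier U \<and>
     \<phi> \<zero>\<^bsub>R\<^esub> = \<zero>\<^bsub>U\<^esub> \<and> \<phi> \<one>\<^bsub>R\<^esub> = \<one>\<^bsub>U\<^esub> \<and>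
     (\<forall>a \<in> carrier R. \<forall>b \<in> carrier R. \<phi> (a \<otimes>\<^bsub>R\<^esub> b) = \<phi> a \<otimes>\<^bsub>U\<^esub> \<phi> b) \<and>
     (\<forall>a \<in> carrier R. \<forall>b \<in> carrier R.
        semiring_le U (ghost_map U \<phi> (a \<oplus>\<^bsub>R\<^esub> b)) (ghost_map U \<phi> a \<oplus>\<^bsub>U\<^esub> ghost_map U \<phi> b))"

text \<open>
  The condition \<open>eU = M\<close> is read up to an isomorphism \<open>\<iota>\<close> of semirings compatible with \<open>v\<close>, since
  the ghost ideal of a quotient \<open>U/E\<close> consists of classes and is only identified with \<open>M\<close>.
  Members of \<^const>\<open>ring_iso\<close> preserve zero, being additive bijections of monoids.
\<close>

definition cover :: "'r ring \<Rightarrow> 'm ring \<Rightarrow> ('r \<Rightarrow> 'm) \<Rightarrow> 'u ring \<Rightarrow> ('r \<Rightarrow> 'u) \<Rightarrow> bool" where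
  "cover R M v U \<phi> \<longleftrightarrow>
     supervaluation R U \<phi> \<and>
     (\<exists>\<iota> \<in> ring_iso M (ghost_semiring U). \<forall>a \<in> carrier R. ghost_map U \<phi> a = \<iota> (v a))"

definition tangibly_surjective :: "'r ring \<Rightarrow> 'u ring \<Rightarrow> ('r \<Rightarrow> 'u) \<Rightarrow> bool" where
  "tangibly_surjective R U \<phi> \<longleftrightarrow> tangibles U \<subseteq> \<phi> ` carrier R"

section \<open>Dominance and the poset of covers\<close>

definition dominates ::
  "'r ring \<Rightarrow> 'u ring \<Rightarrow> ('r \<Rightarrow> 'u) \<Rightarrow> 'w ring \<Rightarrow> ('r \<Rightarrow> 'w) \<Rightarrow> bool" where
  "dominates R U \<phi> V \<psi> \<longleftrightarrow>
     (\<forall>a \<in> carrier R. \<forall>b \<in> carrier R.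
        (\<phi> a = \<phi> b \<longrightarrow> \<psi> a = \<psi> b) \<and>
        (semiring_le U (ghost_map U \<phi> a) (ghost_map U \<phi> b) \<longrightarrow>
           semiring_le V (ghost_map V \<psi> a) (ghost_map V \<psi> b)) \<and>
        (\<phi> a \<in> ghost_ideal U \<longrightarrow> \<psi> a \<in> ghost_ideal V))"

type_synonym ('r, 'u) valued_map = "'u ring \<times> ('r \<Rightarrow> 'u)"

text \<open>
  Equivalence relates covers whose target semirings may live on different types. The class of a
  cover \<open>(U, \<phi>)\<close> is the set of all equivalent covers with target on a type \<open>'w\<close>, which plays the
  role of the universe of the sets \<open>Cov(v)\<close> and \<open>C(\<phi>)\<close>; \<open>(U, \<phi>)\<close> itself need not have its target
  on \<open>'w\<close>. The class is nonempty as soon as \<open>'w\<close> has room for a copy of \<open>U\<close>; as \<open>'w\<close> is arbitrary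
  (e.g. \<open>'u + 'b\<close>), no cover is excluded.
\<close>

definition cover_equiv ::
  "'r ring \<Rightarrow> 'm ring \<Rightarrow> ('r \<Rightarrow> 'm) \<Rightarrow> (('r, 'u) valued_map \<times> ('r, 'w) valued_map) set" where
  "cover_equiv R M v =
     {((U, \<phi>), (V, \<psi>)). cover R M v U \<phi> \<and> cover R M v V \<psi> \<and>
        dominates R U \<phi> V \<psi> \<and> dominates R V \<psi> U \<phi>}"

definition cover_class ::
  "'r ring \<Rightarrow> 'm ring \<Rightarrow> ('r \<Rightarrow> 'm) \<Rightarrow> 'u ring \<Rightarrow> ('r \<Rightarrow> 'u) \<Rightarrow> ('r, 'w) valued_map set" where
  "cover_class R M v U \<phi> = cover_equiv R M v `` {(U, \<phi>)}"

definition Cov :: "'r ring \<Rightarrow> 'm ring \<Rightarrow> ('r \<Rightarrow> 'm) \<Rightarrow> ('r, 'w) valued_map set set" where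
  "Cov R M v = {(V, \<psi>). cover R M v V \<psi>} // cover_equiv R M v"

text \<open>Dominance is invariant under equivalence, so the choice of representatives is immaterial.\<close>

definition Cov_ge ::
  "'r ring \<Rightarrow> ('r, 'w) valued_map set \<Rightarrow> ('r, 'w) valued_map set \<Rightarrow> bool" where
  "Cov_ge R X Y \<longleftrightarrow> (\<exists>(V, \<psi>) \<in> X. \<exists>(W, \<chi>) \<in> Y. dominates R V \<psi> W \<chi>)"

definition dominated_covers ::
  "'r ring \<Rightarrow> 'm ring \<Rightarrow> ('r \<Rightarrow> 'm) \<Rightarrow> 'u ring \<Rightarrow> ('r \<Rightarrow> 'u) \<Rightarrow> ('r, 'w) valued_map set set" where
  "dominated_covers R M v U \<phi> = {X \<in> Cov R M v. Cov_ge R (cover_class R M v U \<phi>) X}"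

section \<open>MFCE-relations and quotients\<close>

definition MFC :: "'u ring \<Rightarrow> ('u \<times> 'u) set set" where
  "MFC U = {E. equiv (carrier U) E \<and>
     (\<forall>(x, y) \<in> E. \<forall>z \<in> carrier U. (x \<otimes>\<^bsub>U\<^esub> z, y \<otimes>\<^bsub>U\<^esub> z) \<in> E) \<and>
     (\<forall>(x, y) \<in> E. ghost_unit U \<otimes>\<^bsub>U\<^esub> x = ghost_unit U \<otimes>\<^bsub>U\<^esub> y)}"

definition quotient_semiring :: "'u ring \<Rightarrow> ('u \<times> 'u) set \<Rightarrow> 'u set ring" where
  "quotient_semiring U E =
     \<lparr>carrier = carrier U // E,
      mult = (\<lambda>X Y. \<Union>x \<in> X. \<Union>y \<in> Y. E `` {x \<otimes>\<^bsub>U\<^esub> y}),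
      one = E `` {\<one>\<^bsub>U\<^esub>},
      zero = E `` {\<zero>\<^bsub>U\<^esub>},
      add = (\<lambda>X Y. \<Union>x \<in> X. \<Union>y \<in> Y. E `` {x \<oplus>\<^bsub>U\<^esub> y})\<rparr>"

definition quotient_map :: "('r \<Rightarrow> 'u) \<Rightarrow> ('u \<times> 'u) set \<Rightarrow> 'r \<Rightarrow> 'u set" where
  "quotient_map \<phi> E a = E `` {\<phi> a}"

definition quotient_class ::
  "'r ring \<Rightarrow> 'm ring \<Rightarrow> ('r \<Rightarrow> 'm) \<Rightarrow> 'u ring \<Rightarrow> ('r \<Rightarrow> 'u) \<Rightarrow> ('u \<times> 'u) set \<Rightarrow>
     ('r, 'w) valued_map set" where
  "quotient_class R M v U \<phi> E = cover_class R M v (quotient_semiring U E) (quotient_map \<phi> E)"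

definition anti_isomorphism ::
  "('a \<Rightarrow> 'b) \<Rightarrow> 'a set \<Rightarrow> ('a \<Rightarrow> 'a \<Rightarrow> bool) \<Rightarrow> 'b set \<Rightarrow> ('b \<Rightarrow> 'b \<Rightarrow> bool) \<Rightarrow> bool" where
  "anti_isomorphism f A le_A B le_B \<longleftrightarrow>
     bij_betw f A B \<and> (\<forall>x \<in> A. \<forall>y \<in> A. le_A x y \<longleftrightarrow> le_B (f y) (f x))"

end

theory Submission
  imports Defs
begin

text \<open>
  A cover of \<open>v\<close> carries exactly two pieces of information beyond \<open>v\<close>: which values of the map
  coincide, and which of them are ghosts (\<open>dominates_covers_iff\<close>). Comparing ghost values, the
  third ingredient of dominance, is already decided by \<open>v\<close>. For a quotient \<open>\<phi>/E\<close> these two pieces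
  are the traces of \<open>E\<close> on pairs \<open>(\<phi> a, \<phi> b)\<close> and \<open>(\<phi> a, e\<phi> a)\<close>. As \<open>\<phi>\<close> hits every tangible and \<open>E\<close>
  conserves fibers, every nontrivial pair of \<open>E\<close> has one of these two forms up to symmetry: two
  related ghosts are equal, and a ghost related to \<open>x\<close> is \<open>ex\<close>. So \<open>E\<close> can be read off from \<open>\<phi>/E\<close>,
  and dominance between quotients is inclusion of relations
  (\<open>dominates_quotients_iff\<close>). This gives injectivity and the order statement.

  For surjectivity, a cover \<open>\<psi>\<close> dominated by \<open>\<phi>\<close> factors as \<open>\<psi> = \<alpha> \<circ> \<phi>\<close> through a multiplicative map
  \<open>\<alpha> : U \<rightarrow> V\<close> that becomes the identity of \<open>M\<close> on ghosts once both ghost ideals are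
  identified with \<open>M\<close> (\<open>dominated_cover_factors\<close>); (D1) and (D3) say precisely that prescribing
  \<open>\<alpha>\<close> on \<open>\<phi>(R)\<close> and on \<open>eU\<close> is consistent, and these two sets exhaust
  \<open>U\<close>. The kernel of \<open>\<alpha>\<close> is the required MFCE-relation (\<open>dominated_cover_is_quotient\<close>).

  Two constructions produce new covers: the quotient \<open>U/E\<close>, and a copy of a semiring on another
  type. Both come with a surjective homomorphism whose kernel conserves fibers. Such a homomorphism
  carries the supertropical axioms over to its target and is injective on ghosts, so composing it
  with a cover of \<open>v\<close> gives a cover of \<open>v\<close> (\<open>fiber_conserving_epi.cover_image\<close>).
\<close>

section \<open>Ghosts\<close>

context supertropical_semiring
begin

lemma ghost_unit_closed [simp, intro]: "ghost_unit U \<in> carrier U"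
  by (simp add: ghost_unit_def)

lemma ghost_unit_mult_eq_double: "x \<in> carrier U \<Longrightarrow> ghost_unit U \<otimes> x = x \<oplus> x"
  by (simp add: ghost_unit_def l_distr)

lemma ghost_unit_idem: "ghost_unit U \<otimes> ghost_unit U = ghost_unit U"
  unfolding ghost_unit_def using four_ones by (simp add: l_distr r_distr a_assoc)

lemma ghost_unit_mult_idem [simp]:
  "x \<in> carrier U \<Longrightarrow> ghost_unit U \<otimes> (ghost_unit U \<otimes> x) = ghost_unit U \<otimes> x"
  by (simp add: m_assoc [symmetric] ghost_unit_idem)

lemma ghost_iff: "x \<in> ghost_ideal U \<longleftrightarrow> x \<in> carrier U \<and> ghost_unit U \<otimes> x = x"
proof
  assume "x \<in> carrier U \<and> ghost_unit U \<otimes> x = x"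
  then show "x \<in> ghost_ideal U"
    unfolding ghost_ideal_def by (metis imageI)
qed (auto simp: ghost_ideal_def)

lemma ghost_mult_left:
  assumes "x \<in> ghost_ideal U" "y \<in> carrier U"
  shows "x \<otimes> y = x \<otimes> (ghost_unit U \<otimes> y)"
proof -
  have x: "x \<in> carrier U" "ghost_unit U \<otimes> x = x" using assms(1) by (auto simp: ghost_iff)
  have "x \<otimes> (ghost_unit U \<otimes> y) = ghost_unit U \<otimes> x \<otimes> y"
    using x(1) assms(2) by (simp add: m_lcomm m_assoc)
  then show ?thesis by (simp add: x)
qed

end

lemma supertropical_if_cover: "cover R M v U \<phi> \<Longrightarrow> supertropical_semiring U"
  by (simp add: cover_def supervaluation_def)

lemma cover_closed: "\<lbrakk>cover R M v U \<phi>; a \<in> carrier R\<rbrakk> \<Longrightarrow> \<phi> a \<in> carrier U"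
  by (auto simp: cover_def supervaluation_def)

lemma cover_mult:
  "\<lbrakk>cover R M v U \<phi>; a \<in> carrier R; b \<in> carrier R\<rbrakk> \<Longrightarrow> \<phi> (a \<otimes>\<^bsub>R\<^esub> b) = \<phi> a \<otimes>\<^bsub>U\<^esub> \<phi> b"
  by (auto simp: cover_def supervaluation_def)

section \<open>Surjective homomorphisms with fiber conserving kernel\<close>

locale fiber_conserving_epi = supertropical_semiring U for U :: "'u ring" (structure) +
  fixes V :: "'w ring" (structure) and f :: "'u \<Rightarrow> 'w"
  assumes hom: "f \<in> ring_hom U V"
    and zero: "f \<zero> = \<zero>\<^bsub>V\<^esub>"
    and surj: "f ` carrier U = carrier V"
    and conserves_fibers:
      "\<lbrakk>x \<in> carrier U; y \<in> carrier U; f x = f y\<rbrakk> \<Longrightarrow> ghost_unit U \<otimes> x = ghost_unit U \<otimes> y"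
begin

lemmas hom_mult [simp] = ring_hom_mult [OF hom]
  and hom_add [simp] = ring_hom_add [OF hom]
  and hom_closed [simp] = ring_hom_closed [OF hom]
  and hom_one = ring_hom_one [OF hom]

lemma commutative_semiring_image: "commutative_semiring V"
proof -
  have ex: "\<exists>u \<in> carrier U. x = f u" if "x \<in> carrier V" for x
    using that surj by auto
  note cl = zero [symmetric] hom_one [symmetric] hom_add [symmetric] hom_mult [symmetric]
  have "abelian_monoid V"
    by (rule abelian_monoidI)
       (auto dest!: ex simp: cl a_ac simp del: hom_add hom_mult)
  moreover have "comm_monoid V"
    by (rule comm_monoidI)
       (auto dest!: ex simp: cl m_ac simp del: hom_add hom_mult)
  moreover have "semiring_axioms V"
    by (rule semiring_axioms.intro)
       (auto dest!: ex simp: cl l_distr r_distr simp del: hom_add hom_mult)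
  ultimately show ?thesis
    by (simp add: commutative_semiring_def semiring_def comm_monoid.axioms)
qed

lemma double_eq_iff:
  assumes "x \<in> carrier U" "y \<in> carrier U"
  shows "f x \<oplus>\<^bsub>V\<^esub> f x = f y \<oplus>\<^bsub>V\<^esub> f y \<longleftrightarrow> x \<oplus> x = y \<oplus> y"
proof
  assume "f x \<oplus>\<^bsub>V\<^esub> f x = f y \<oplus>\<^bsub>V\<^esub> f y"
  then have "f (x \<oplus> x) = f (y \<oplus> y)" using assms by simp
  then have "ghost_unit U \<otimes> (x \<oplus> x) = ghost_unit U \<otimes> (y \<oplus> y)"
    using assms by (intro conserves_fibers) auto
  then show "x \<oplus> x = y \<oplus> y"
    using assms by (simp flip: ghost_unit_mult_eq_double)
next
  assume "x \<oplus> x = y \<oplus> y"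
  then show "f x \<oplus>\<^bsub>V\<^esub> f x = f y \<oplus>\<^bsub>V\<^esub> f y"
    using assms by (metis hom_add)
qed

text \<open>
  The supertropical axioms are case distinctions on equality of \<open>x + x = ex\<close> and \<open>y + y = ey\<close>,
  which the homomorphism neither creates nor destroys.
\<close>
lemma supertropical_image: "supertropical_semiring V"
proof (rule supertropical_semiring.intro [OF commutative_semiring_image], unfold_locales)
  have "f (\<one> \<oplus> \<one>) = f (\<one> \<oplus> \<one> \<oplus> \<one> \<oplus> \<one>)" by (simp only: four_ones [symmetric])
  then show "\<one>\<^bsub>V\<^esub> \<oplus>\<^bsub>V\<^esub> \<one>\<^bsub>V\<^esub> = \<one>\<^bsub>V\<^esub> \<oplus>\<^bsub>V\<^esub> \<one>\<^bsub>V\<^esub> \<oplus>\<^bsub>V\<^esub> \<one>\<^bsub>V\<^esub> \<oplus>\<^bsub>V\<^esub> \<one>\<^bsub>V\<^esub>"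
    by (simp add: hom_one)
next
  fix a b
  assume ab: "a \<in> carrier V" "b \<in> carrier V"
  then obtain x y where xy: "x \<in> carrier U" "y \<in> carrier U" and [simp]: "a = f x" "b = f y"
    unfolding surj [symmetric] by blast
  {
    assume "a \<oplus>\<^bsub>V\<^esub> a = b \<oplus>\<^bsub>V\<^esub> b"
    then have "x \<oplus> y = x \<oplus> x" using xy by (simp add: double_eq_iff [OF xy] add_same_ghost [OF xy])
    then show "a \<oplus>\<^bsub>V\<^esub> b = a \<oplus>\<^bsub>V\<^esub> a" using xy by (simp flip: hom_add)
  next
    assume "a \<oplus>\<^bsub>V\<^esub> a \<noteq> b \<oplus>\<^bsub>V\<^esub> b"
    then have "x \<oplus> y \<in> {x, y}" using add_diff_ghost [OF xy] by (simp add: double_eq_iff [OF xy])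
    then have "f (x \<oplus> y) \<in> {a, b}" by auto
    then show "a \<oplus>\<^bsub>V\<^esub> b \<in> {a, b}" using xy by simp
  }
qed

lemma hom_ghost_unit: "f (ghost_unit U) = ghost_unit V"
  by (simp add: ghost_unit_def hom_one)

lemma hom_ghost_unit_mult: "x \<in> carrier U \<Longrightarrow> f (ghost_unit U \<otimes> x) = ghost_unit V \<otimes>\<^bsub>V\<^esub> f x"
  by (simp add: hom_ghost_unit)

lemma ghost_ideal_image: "f ` ghost_ideal U = ghost_ideal V"
  unfolding ghost_ideal_def surj [symmetric] image_image
  by (rule image_cong) (simp_all add: hom_ghost_unit)

lemma inj_on_ghosts: "inj_on f (ghost_ideal U)"
  by (rule inj_onI) (metis conserves_fibers ghost_iff)

lemma ghost_iso: "f \<in> ring_iso (ghost_semiring U) (ghost_semiring V)"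
proof (rule ring_iso_memI)
  show "bij_betw f (carrier (ghost_semiring U)) (carrier (ghost_semiring V))"
    using inj_on_ghosts ghost_ideal_image by (simp add: bij_betw_def ghost_semiring_def)
qed (use ghost_ideal_image in \<open>auto simp: ghost_semiring_def ghost_iff hom_ghost_unit\<close>)

lemma cover_image:
  assumes "commutative_semiring R"
    and "cover R M v U \<phi>"
    and \<psi>: "\<And>a. \<psi> a = f (\<phi> a)"
  shows "cover R M v V \<psi>"
proof -
  from assms(2) obtain \<iota> where sv: "supervaluation R U \<phi>"
    and \<iota>: "\<iota> \<in> ring_iso M (ghost_semiring U)" "\<forall>a \<in> carrier R. ghost_map U \<phi> a = \<iota> (v a)"
    by (auto simp: cover_def)
  from sv have \<phi>: "\<phi> \<in> carrier R \<rightarrow> carrier U" by (simp add: supervaluation_def)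
  have gm: "ghost_map V \<psi> a = f (ghost_map U \<phi> a)" if "\<phi> a \<in> carrier U" for a
    using that by (simp add: ghost_map_def \<psi> hom_ghost_unit)
  have le: "semiring_le V (ghost_map V \<psi> (a \<oplus>\<^bsub>R\<^esub> b)) (ghost_map V \<psi> a \<oplus>\<^bsub>V\<^esub> ghost_map V \<psi> b)"
    if ab: "a \<in> carrier R" "b \<in> carrier R" for a b
  proof -
    interpret R: commutative_semiring R by fact
    have "ghost_map U \<phi> (a \<oplus>\<^bsub>R\<^esub> b) \<oplus> (ghost_map U \<phi> a \<oplus> ghost_map U \<phi> b)
        = ghost_map U \<phi> a \<oplus> ghost_map U \<phi> b"
      using sv ab by (simp add: supervaluation_def semiring_le_def)
    moreover have "\<phi> a \<in> carrier U" "\<phi> b \<in> carrier U" "\<phi> (a \<oplus>\<^bsub>R\<^esub> b) \<in> carrier U"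
      using \<phi> ab by auto
    moreover have "ghost_map U \<phi> c \<in> carrier U" if "\<phi> c \<in> carrier U" for c
      using that by (simp add: ghost_map_def)
    ultimately show ?thesis
      unfolding semiring_le_def by (simp add: gm flip: hom_add)
  qed
  have "supervaluation R V \<psi>"
    using sv le supertropical_image \<phi>
    by (auto simp: supervaluation_def \<psi> zero hom_one Pi_iff)
  moreover have "f \<circ> \<iota> \<in> ring_iso M (ghost_semiring V)"
    using ring_hom_trans [of \<iota> M "ghost_semiring U" f "ghost_semiring V"] \<iota>(1) ghost_iso
    by (auto simp: ring_iso_def intro: bij_betw_trans)
  ultimately show ?thesis
    using \<iota>(2) gm funcset_mem [OF \<phi>]
    unfolding cover_def by (intro conjI bexI [of _ "f \<circ> \<iota>"]) auto
qed

end

section \<open>Dominance between covers\<close>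

lemma dominates_trans:
  "\<lbrakk>dominates R U \<phi> V \<psi>; dominates R V \<psi> W \<chi>\<rbrakk> \<Longrightarrow> dominates R U \<phi> W \<chi>"
  unfolding dominates_def by meson

lemma cover_ghost_le_iff:
  assumes "m_valuation R M v" "cover R M v U \<phi>" "a \<in> carrier R" "b \<in> carrier R"
  shows "semiring_le U (ghost_map U \<phi> a) (ghost_map U \<phi> b) \<longleftrightarrow> semiring_le M (v a) (v b)"
proof -
  interpret M: bipotent_semiring M using assms(1) by (simp add: m_valuation_def)
  obtain \<iota> where \<iota>: "\<iota> \<in> ring_iso M (ghost_semiring U)" "\<forall>a \<in> carrier R. ghost_map U \<phi> a = \<iota> (v a)"
    using assms(2) by (auto simp: cover_def)
  have v: "v a \<in> carrier M" "v b \<in> carrier M"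
    using assms by (auto simp: m_valuation_def)
  have "\<iota> (v a) \<oplus>\<^bsub>U\<^esub> \<iota> (v b) = \<iota> (v a \<oplus>\<^bsub>M\<^esub> v b)"
    using ring_iso_memE(3) [OF \<iota>(1) v] by (simp add: ghost_semiring_def)
  moreover have "inj_on \<iota> (carrier M)"
    using ring_iso_memE(5) [OF \<iota>(1)] by (rule bij_betw_imp_inj_on)
  ultimately show ?thesis
    using v assms(3,4) \<iota>(2) by (simp add: semiring_le_def inj_on_eq_iff)
qed

text \<open>Condition (D2) is automatic, since both covers order the ghost values as \<open>v\<close> does.\<close>
lemma dominates_covers_iff:
  assumes "m_valuation R M v" "cover R M v U \<phi>" "cover R M v V \<psi>"
  shows "dominates R U \<phi> V \<psi> \<longleftrightarrow>
    (\<forall>a \<in> carrier R. \<forall>b \<in> carrier R. \<phi> a = \<phi> b \<longrightarrow> \<psi> a = \<psi> b) \<and>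
    (\<forall>a \<in> carrier R. ghost_map U \<phi> a = \<phi> a \<longrightarrow> ghost_map V \<psi> a = \<psi> a)"
proof -
  interpret U: supertropical_semiring U using assms(2) by (rule supertropical_if_cover)
  interpret V: supertropical_semiring V using assms(3) by (rule supertropical_if_cover)
  have "\<phi> a \<in> ghost_ideal U \<longleftrightarrow> ghost_map U \<phi> a = \<phi> a"
    and "\<psi> a \<in> ghost_ideal V \<longleftrightarrow> ghost_map V \<psi> a = \<psi> a" if "a \<in> carrier R" for a
    using that cover_closed [OF assms(2)] cover_closed [OF assms(3)]
    by (simp_all add: U.ghost_iff V.ghost_iff ghost_map_def)
  then show ?thesis
    using cover_ghost_le_iff [OF assms(1,2)] cover_ghost_le_iff [OF assms(1,3)]
    unfolding dominates_def by blast
qed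

section \<open>Quotients by MFCE-relations\<close>

lemma MFC_D:
  assumes "E \<in> MFC U"
  shows "equiv (carrier U) E"
    and "\<And>x y z. \<lbrakk>(x, y) \<in> E; z \<in> carrier U\<rbrakk> \<Longrightarrow> (x \<otimes>\<^bsub>U\<^esub> z, y \<otimes>\<^bsub>U\<^esub> z) \<in> E"
    and "\<And>x y. (x, y) \<in> E \<Longrightarrow> ghost_unit U \<otimes>\<^bsub>U\<^esub> x = ghost_unit U \<otimes>\<^bsub>U\<^esub> y"
    and "\<And>x y. (x, y) \<in> E \<Longrightarrow> x \<in> carrier U \<and> y \<in> carrier U"
  using assms equiv_type by (fastforce simp: MFC_def)+

text \<open>
  Since the operation is commutative, compatibility in one argument suffices for computing it on
  classes through representatives.
\<close>
lemma UN_equiv_class_op: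
  assumes E: "equiv A E"
    and comm: "\<And>x y. \<lbrakk>x \<in> A; y \<in> A\<rbrakk> \<Longrightarrow> g x y = g y x"
    and right: "\<And>x y z. \<lbrakk>(x, y) \<in> E; z \<in> A\<rbrakk> \<Longrightarrow> (g x z, g y z) \<in> E"
    and xy: "x \<in> A" "y \<in> A"
  shows "(\<Union>x' \<in> E `` {x}. \<Union>y' \<in> E `` {y}. E `` {g x' y'}) = E `` {g x y}"
proof -
  have "congruent2 E E (\<lambda>x y. E `` {g x y})"
  proof (rule congruent2_commuteI [OF E])
    fix y z w
    assume "w \<in> A" "(y, z) \<in> E"
    then have "(g y w, g z w) \<in> E" and yz: "y \<in> A" "z \<in> A"
      using right equiv_type [OF E] by auto
    then show "E `` {g w y} = E `` {g w z}"
      using comm \<open>w \<in> A\<close> equiv_class_eq [OF E] by metis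
  qed (simp add: comm)
  then show ?thesis
    using UN_equiv_class2 [OF E E _ xy] by blast
qed

context
  fixes U :: "'u ring" (structure)
  assumes supertropical: "supertropical_semiring U"
begin

interpretation supertropical_semiring U by (rule supertropical)

text \<open>
  A sum is determined by the ghosts of its summands: it is the common ghost if these agree, and
  otherwise the summand with the larger ghost. Conserving fibers is therefore all that an
  equivalence relation needs in order to respect addition.
\<close>
lemma MFC_add_right:
  assumes E: "E \<in> MFC U" and xy: "(x, y) \<in> E" and z: "z \<in> carrier U"
  shows "(x \<oplus> z, y \<oplus> z) \<in> E"
proof -
  note MFC = MFC_D [OF E]
  have x: "x \<in> carrier U" and y: "y \<in> carrier U" using MFC(4) [OF xy] by auto
  have g: "x \<oplus> x = y \<oplus> y"
    using MFC(3) [OF xy] x y by (simp add: ghost_unit_mult_eq_double)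
  have refl: "(u, u) \<in> E" if "u \<in> carrier U" for u
    using MFC(1) that by (simp add: equiv_def refl_on_def)
  show ?thesis
  proof (cases "x \<oplus> x = z \<oplus> z")
    case True
    then have "x \<oplus> z = x \<oplus> x" "y \<oplus> z = y \<oplus> y"
      using g x y z add_same_ghost [of x z] add_same_ghost [of y z] by simp_all
    then show ?thesis using g refl y by simp
  next
    case False
    (* Doubling both sides of a hypothetical sum shows which summand has the larger ghost. *)
    have dbl: "(u \<oplus> z) \<oplus> (u \<oplus> z) = (u \<oplus> u) \<oplus> (z \<oplus> z)" if "u \<in> carrier U" for u
      using that z by (simp add: a_ac)
    have "x \<oplus> z \<in> {x, z}" "y \<oplus> z \<in> {y, z}"
      using False g x y z by (auto dest: add_diff_ghost)
    moreover have "x \<oplus> z = x \<Longrightarrow> y \<oplus> z \<noteq> z" "x \<oplus> z = z \<Longrightarrow> y \<oplus> z \<noteq> y"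
      using dbl [OF x] dbl [OF y] g False by auto
    ultimately show ?thesis using xy refl z by auto
  qed
qed

lemma quotient_fiber_conserving_epi:
  assumes E: "E \<in> MFC U"
  shows "fiber_conserving_epi U (quotient_semiring U E) (\<lambda>x. E `` {x})"
proof unfold_locales
  note MFC = MFC_D [OF E]
  have mult: "mult (quotient_semiring U E) (E `` {x}) (E `` {y}) = E `` {x \<otimes> y}"
    and add: "add (quotient_semiring U E) (E `` {x}) (E `` {y}) = E `` {x \<oplus> y}"
    if "x \<in> carrier U" "y \<in> carrier U" for x y
    unfolding quotient_semiring_def
    using that UN_equiv_class_op [OF MFC(1), where g = "(\<otimes>)"] MFC(2) m_comm
      UN_equiv_class_op [OF MFC(1), where g = "(\<oplus>)"] MFC_add_right [OF E] a_comm
    by simp_all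
  show "(\<lambda>x. E `` {x}) \<in> ring_hom U (quotient_semiring U E)"
    by (rule ring_hom_memI) (simp_all add: mult add, auto simp: quotient_semiring_def quotientI)
  show "E `` {\<zero>} = \<zero>\<^bsub>quotient_semiring U E\<^esub>"
    by (simp add: quotient_semiring_def)
  show "(\<lambda>x. E `` {x}) ` carrier U = carrier (quotient_semiring U E)"
    by (auto simp: quotient_semiring_def quotient_def)
  show "ghost_unit U \<otimes> x = ghost_unit U \<otimes> y"
    if "x \<in> carrier U" "y \<in> carrier U" "E `` {x} = E `` {y}" for x y
    using that MFC(1,3) eq_equiv_class by metis
qed

end

lemma cover_quotient:
  assumes "commutative_semiring R" "cover R M v U \<phi>" "E \<in> MFC U"
  shows "cover R M v (quotient_semiring U E) (quotient_map \<phi> E)"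
proof -
  interpret supertropical_semiring U using assms(2) by (rule supertropical_if_cover)
  interpret fiber_conserving_epi U "quotient_semiring U E" "\<lambda>x. E `` {x}"
    using assms(3) by (rule quotient_fiber_conserving_epi [OF supertropical_semiring_axioms])
  show ?thesis
    using assms(1,2) by (rule cover_image) (simp add: quotient_map_def)
qed

lemma quotient_map_eq_iff:
  assumes "cover R M v U \<phi>" "E \<in> MFC U" "a \<in> carrier R" "b \<in> carrier R"
  shows "quotient_map \<phi> E a = quotient_map \<phi> E b \<longleftrightarrow> (\<phi> a, \<phi> b) \<in> E"
proof -
  interpret supertropical_semiring U using assms(1) by (rule supertropical_if_cover)
  show ?thesis
    unfolding quotient_map_def
    using MFC_D(1) [OF assms(2)] assms cover_closed [OF assms(1)] by (simp add: eq_equiv_class_iff)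
qed

lemma quotient_map_ghost_iff:
  assumes "cover R M v U \<phi>" "E \<in> MFC U" "a \<in> carrier R"
  shows "ghost_map (quotient_semiring U E) (quotient_map \<phi> E) a = quotient_map \<phi> E a \<longleftrightarrow>
    (ghost_map U \<phi> a, \<phi> a) \<in> E"
proof -
  interpret supertropical_semiring U using assms(1) by (rule supertropical_if_cover)
  interpret fiber_conserving_epi U "quotient_semiring U E" "\<lambda>x. E `` {x}"
    using assms(2) by (rule quotient_fiber_conserving_epi [OF supertropical_semiring_axioms])
  have "\<phi> a \<in> carrier U" using assms(1,3) by (rule cover_closed)
  then have "ghost_map (quotient_semiring U E) (quotient_map \<phi> E) a = E `` {ghost_map U \<phi> a}"
    by (simp add: ghost_map_def quotient_map_def flip: hom_ghost_unit_mult del: hom_mult)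
  then show ?thesis
    using eq_equiv_class_iff [OF MFC_D(1) [OF assms(2)]] \<open>\<phi> a \<in> carrier U\<close>
    by (simp add: quotient_map_def ghost_map_def del: hom_mult)
qed

lemma tangible_or_ghost:
  assumes "tangibly_surjective R U \<phi>" "x \<in> carrier U"
  obtains (ghost) "x \<in> ghost_ideal U" | (image) a where "a \<in> carrier R" "x = \<phi> a"
  using assms by (auto simp: tangibly_surjective_def tangibles_def)

lemma dominates_quotients_iff:
  assumes R: "commutative_semiring R" and v: "m_valuation R M v" and U: "cover R M v U \<phi>"
    and surj: "tangibly_surjective R U \<phi>" and E: "E \<in> MFC U" and F: "F \<in> MFC U"
  shows "dominates R (quotient_semiring U E) (quotient_map \<phi> E)
      (quotient_semiring U F) (quotient_map \<phi> F) \<longleftrightarrow> E \<subseteq> F"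
    (is "?dom \<longleftrightarrow> _")
proof -
  interpret supertropical_semiring U using U by (rule supertropical_if_cover)
  note E' = MFC_D [OF E] and F' = MFC_D [OF F]
  have "?dom \<longleftrightarrow> (\<forall>a \<in> carrier R. \<forall>b \<in> carrier R. (\<phi> a, \<phi> b) \<in> E \<longrightarrow> (\<phi> a, \<phi> b) \<in> F) \<and>
      (\<forall>a \<in> carrier R. (ghost_map U \<phi> a, \<phi> a) \<in> E \<longrightarrow> (ghost_map U \<phi> a, \<phi> a) \<in> F)"
    using dominates_covers_iff [OF v cover_quotient [OF R U E] cover_quotient [OF R U F]]
      quotient_map_eq_iff [OF U E] quotient_map_eq_iff [OF U F]
      quotient_map_ghost_iff [OF U E] quotient_map_ghost_iff [OF U F]
    by simp
  also have "\<dots> \<longleftrightarrow> E \<subseteq> F" (is "?L \<longleftrightarrow> _")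
  proof
    assume L: ?L
    have ghost: "(x, y) \<in> F" if xy: "(x, y) \<in> E" and x: "x \<in> ghost_ideal U" for x y
    proof -
      (* Fiber conservation pins the ghost down: it is the ghost of its partner. *)
      have x_eq: "x = ghost_unit U \<otimes>\<^bsub>U\<^esub> y" using E'(3) [OF xy] x by (simp add: ghost_iff)
      have "y \<in> carrier U" using E'(4) [OF xy] by simp
      with surj show ?thesis
      proof (cases rule: tangible_or_ghost)
        case ghost
        then have "x = y" using x_eq by (simp add: ghost_iff)
        then show ?thesis using F'(1) \<open>y \<in> carrier U\<close> by (simp add: equiv_def refl_on_def)
      next
        case (image a)
        then show ?thesis using L xy x_eq by (simp add: ghost_map_def)
      qed
    qed
    show "E \<subseteq> F"
    proof (rule subrelI)
      fix x y
      assume xy: "(x, y) \<in> E"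
      then have yx: "(y, x) \<in> E" using E'(1) by (auto simp: equiv_def dest: symD)
      have "x \<in> carrier U" "y \<in> carrier U" using E'(4) [OF xy] by auto
      show "(x, y) \<in> F"
      proof (cases "x \<in> ghost_ideal U \<or> y \<in> ghost_ideal U")
        case True
        then have "(x, y) \<in> F \<or> (y, x) \<in> F" using ghost xy yx by blast
        then show ?thesis using F'(1) by (auto simp: equiv_def dest: symD)
      next
        case False
        then show ?thesis
          using L xy tangible_or_ghost [OF surj \<open>x \<in> carrier U\<close>]
            tangible_or_ghost [OF surj \<open>y \<in> carrier U\<close>] by metis
      qed
    qed
  qed blast
  finally show ?thesis .
qed

section \<open>Dominated covers are quotients\<close>

text \<open>
  Let \<open>\<iota>\<close> and \<open>\<kappa>\<close> identify \<open>M\<close> with the ghost ideals of \<open>U\<close> and \<open>V\<close>. On ghosts \<open>\<alpha>\<close> is the composite of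
  \<open>\<kappa>\<close> with the inverse of \<open>\<iota>\<close>, and on values of \<open>\<phi>\<close> it is forced by \<open>\<psi> = \<alpha> \<circ> \<phi>\<close>. The two prescriptions
  meet at those \<open>\<phi> a\<close> that are ghosts, where (D3) makes \<open>\<psi> a\<close> a ghost too, so that both give \<open>\<kappa> (v a)\<close>.
  A product with a ghost \<open>x\<close> depends only on the ghost of the other factor, because \<open>xy = x(ey)\<close>; so
  multiplicativity can be checked on pairs of ghosts and on pairs of values of \<open>\<phi>\<close>.
\<close>
lemma dominated_cover_factors:
  assumes R: "commutative_semiring R" and v: "m_valuation R M v" and U: "cover R M v U \<phi>"
    and surj: "tangibly_surjective R U \<phi>" and V: "cover R M v V \<psi>"
    and dom: "dominates R U \<phi> V \<psi>"
  obtains \<alpha> where "\<alpha> \<in> carrier U \<rightarrow> carrier V"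
    and "\<And>a. a \<in> carrier R \<Longrightarrow> \<alpha> (\<phi> a) = \<psi> a"
    and "\<And>x y. \<lbrakk>x \<in> carrier U; y \<in> carrier U\<rbrakk> \<Longrightarrow> \<alpha> (x \<otimes>\<^bsub>U\<^esub> y) = \<alpha> x \<otimes>\<^bsub>V\<^esub> \<alpha> y"
    and "\<And>x. x \<in> carrier U \<Longrightarrow> \<alpha> (ghost_unit U \<otimes>\<^bsub>U\<^esub> x) = ghost_unit V \<otimes>\<^bsub>V\<^esub> \<alpha> x"
    and "inj_on \<alpha> (ghost_ideal U)"
proof -
  interpret R: commutative_semiring R by fact
  interpret U: supertropical_semiring U using U by (rule supertropical_if_cover)
  interpret V: supertropical_semiring V using V by (rule supertropical_if_cover)
  interpret M: bipotent_semiring M using v by (simp add: m_valuation_def)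
  obtain \<iota> where \<iota>: "\<iota> \<in> ring_iso M (ghost_semiring U)"
    and \<iota>v: "\<And>a. a \<in> carrier R \<Longrightarrow> ghost_unit U \<otimes>\<^bsub>U\<^esub> \<phi> a = \<iota> (v a)"
    using U by (auto simp: cover_def ghost_map_def)
  obtain \<kappa> where \<kappa>: "\<kappa> \<in> ring_iso M (ghost_semiring V)"
    and \<kappa>v: "\<And>a. a \<in> carrier R \<Longrightarrow> ghost_unit V \<otimes>\<^bsub>V\<^esub> \<psi> a = \<kappa> (v a)"
    using V by (auto simp: cover_def ghost_map_def)
  have v_closed: "v a \<in> carrier M" if "a \<in> carrier R" for a
    using v that by (auto simp: m_valuation_def)
  note \<phi>_closed = cover_closed [OF U] and \<psi>_closed = cover_closed [OF V]
  have \<iota>_inj: "inj_on \<iota> (carrier M)" and \<iota>_surj: "\<iota> ` carrier M = ghost_ideal U"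
    and \<iota>_mult: "\<And>m n. \<lbrakk>m \<in> carrier M; n \<in> carrier M\<rbrakk> \<Longrightarrow> \<iota> (m \<otimes>\<^bsub>M\<^esub> n) = \<iota> m \<otimes>\<^bsub>U\<^esub> \<iota> n"
    using ring_iso_memE [OF \<iota>] by (auto simp: bij_betw_def ghost_semiring_def)
  have \<kappa>_inj: "inj_on \<kappa> (carrier M)" and \<kappa>_ghost: "\<And>m. m \<in> carrier M \<Longrightarrow> \<kappa> m \<in> ghost_ideal V"
    and \<kappa>_mult: "\<And>m n. \<lbrakk>m \<in> carrier M; n \<in> carrier M\<rbrakk> \<Longrightarrow> \<kappa> (m \<otimes>\<^bsub>M\<^esub> n) = \<kappa> m \<otimes>\<^bsub>V\<^esub> \<kappa> n"
    using ring_iso_memE [OF \<kappa>] by (auto simp: bij_betw_def ghost_semiring_def)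
  have \<iota>_ghost: "\<iota> m \<in> ghost_ideal U" if "m \<in> carrier M" for m
    using that \<iota>_surj by blast

  have consistent: "\<kappa> m = \<psi> a" if "m \<in> carrier M" "a \<in> carrier R" "\<iota> m = \<phi> a" for m a
  proof -
    have "\<phi> a \<in> ghost_ideal U" using that \<iota>_ghost by metis
    then have "\<psi> a \<in> ghost_ideal V" using dom that(2) unfolding dominates_def by blast
    then have "\<psi> a = \<kappa> (v a)" using \<kappa>v that(2) by (simp add: V.ghost_iff)
    moreover have "\<phi> a = \<iota> (v a)"
      using \<open>\<phi> a \<in> ghost_ideal U\<close> \<iota>v that(2) by (simp add: U.ghost_iff)
    ultimately show ?thesis
      using that \<iota>_inj v_closed by (simp add: inj_on_eq_iff)
  qed
  have \<psi>_eq: "\<psi> a = \<psi> b" if "\<phi> a = \<phi> b" "a \<in> carrier R" "b \<in> carrier R" for a b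
    using dom that unfolding dominates_def by blast
  have "\<exists>y. y \<in> carrier V \<and> (\<forall>m \<in> carrier M. x = \<iota> m \<longrightarrow> y = \<kappa> m) \<and>
      (\<forall>a \<in> carrier R. x = \<phi> a \<longrightarrow> y = \<psi> a)" if "x \<in> carrier U" for x
    using surj that
  proof (cases rule: tangible_or_ghost)
    case ghost
    then obtain m where m: "m \<in> carrier M" "x = \<iota> m" using \<iota>_surj by blast
    have "\<kappa> m = \<kappa> n" if "n \<in> carrier M" "x = \<iota> n" for n
      using inj_onD [OF \<iota>_inj, of m n] that m by simp
    moreover have "\<kappa> m = \<psi> a" if "a \<in> carrier R" "x = \<phi> a" for a
      using consistent [OF m(1) that(1)] that(2) m(2) by simp
    moreover have "\<kappa> m \<in> carrier V" using \<kappa>_ghost [OF m(1)] by (simp add: V.ghost_iff)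
    ultimately show ?thesis by blast
  next
    case (image a)
    have "\<psi> a = \<kappa> m" if "m \<in> carrier M" "x = \<iota> m" for m
      using consistent [OF that(1) image(1)] that(2) image(2) by simp
    moreover have "\<psi> a = \<psi> b" if "b \<in> carrier R" "x = \<phi> b" for b
      using \<psi>_eq [OF _ image(1) that(1)] that(2) image(2) by simp
    ultimately show ?thesis using \<psi>_closed [OF image(1)] by blast
  qed
  then obtain \<alpha> where \<alpha>: "\<And>x. x \<in> carrier U \<Longrightarrow> \<alpha> x \<in> carrier V \<and>
      (\<forall>m \<in> carrier M. x = \<iota> m \<longrightarrow> \<alpha> x = \<kappa> m) \<and> (\<forall>a \<in> carrier R. x = \<phi> a \<longrightarrow> \<alpha> x = \<psi> a)"
    by metis
  have \<alpha>_ghost: "\<alpha> (\<iota> m) = \<kappa> m" if "m \<in> carrier M" for m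
    using \<alpha> that \<iota>_ghost by (auto simp: U.ghost_iff)
  have \<alpha>\<phi>: "\<alpha> (\<phi> a) = \<psi> a" if "a \<in> carrier R" for a
    using \<alpha> that \<phi>_closed by blast
  have \<alpha>_closed: "\<alpha> x \<in> carrier V" if "x \<in> carrier U" for x
    using \<alpha> that by blast

  have \<alpha>_ghost_unit: "\<alpha> (ghost_unit U \<otimes>\<^bsub>U\<^esub> x) = ghost_unit V \<otimes>\<^bsub>V\<^esub> \<alpha> x" if "x \<in> carrier U" for x
    using surj that
  proof (cases rule: tangible_or_ghost)
    case ghost
    then obtain m where "m \<in> carrier M" "x = \<iota> m" using \<iota>_surj by blast
    then show ?thesis
      using \<alpha>_ghost \<kappa>_ghost \<iota>_ghost by (simp add: U.ghost_iff V.ghost_iff)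
  next
    case (image a)
    then show ?thesis using \<iota>v \<kappa>v \<alpha>_ghost \<alpha>\<phi> v_closed by simp
  qed
  have \<alpha>_ghosts: "\<alpha> x \<in> ghost_ideal V" if "x \<in> ghost_ideal U" for x
    using that \<alpha>_ghost_unit [of x] \<alpha>_closed by (simp add: U.ghost_iff V.ghost_iff)
  have mult_ghosts: "\<alpha> (x \<otimes>\<^bsub>U\<^esub> y) = \<alpha> x \<otimes>\<^bsub>V\<^esub> \<alpha> y" 
    if x: "x \<in> ghost_ideal U" and y: "y \<in> ghost_ideal U" for x y
  proof -
    obtain m where m: "m \<in> carrier M" "x = \<iota> m" using x \<iota>_surj by blast
    obtain n where n: "n \<in> carrier M" "y = \<iota> n" using y \<iota>_surj by blast
    have "\<alpha> (x \<otimes>\<^bsub>U\<^esub> y) = \<alpha> (\<iota> (m \<otimes>\<^bsub>M\<^esub> n))" using m n by (simp add: \<iota>_mult)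
    then show ?thesis using m n by (simp add: \<alpha>_ghost \<kappa>_mult)
  qed
  have mult_ghost: "\<alpha> (x \<otimes>\<^bsub>U\<^esub> y) = \<alpha> x \<otimes>\<^bsub>V\<^esub> \<alpha> y" if x: "x \<in> ghost_ideal U" and y: "y \<in> carrier U" for x y
  proof -
    have "\<alpha> (x \<otimes>\<^bsub>U\<^esub> y) = \<alpha> (x \<otimes>\<^bsub>U\<^esub> (ghost_unit U \<otimes>\<^bsub>U\<^esub> y))"
      using U.ghost_mult_left [OF x y] by simp
    also have "\<dots> = \<alpha> x \<otimes>\<^bsub>V\<^esub> (ghost_unit V \<otimes>\<^bsub>V\<^esub> \<alpha> y)"
      using x y by (subst mult_ghosts) (auto simp: ghost_ideal_def \<alpha>_ghost_unit)
    also have "\<dots> = \<alpha> x \<otimes>\<^bsub>V\<^esub> \<alpha> y"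
      using V.ghost_mult_left [OF \<alpha>_ghosts [OF x] \<alpha>_closed [OF y]] by simp
    finally show ?thesis .
  qed
  have "\<alpha> (x \<otimes>\<^bsub>U\<^esub> y) = \<alpha> x \<otimes>\<^bsub>V\<^esub> \<alpha> y" if x: "x \<in> carrier U" and y: "y \<in> carrier U" for x y
  proof (cases "x \<in> ghost_ideal U \<or> y \<in> ghost_ideal U")
    case True
    then show ?thesis
      using mult_ghost x y U.m_comm V.m_comm \<alpha>_closed by metis
  next
    case False
    then obtain a b where "a \<in> carrier R" "x = \<phi> a" "b \<in> carrier R" "y = \<phi> b"
      using tangible_or_ghost [OF surj x] tangible_or_ghost [OF surj y] by metis
    then show ?thesis
      using \<alpha>\<phi> [of "a \<otimes>\<^bsub>R\<^esub> b"] \<alpha>\<phi> cover_mult [OF U] cover_mult [OF V] by simp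
  qed
  moreover have "inj_on \<alpha> (ghost_ideal U)"
    unfolding \<iota>_surj [symmetric] using \<kappa>_inj by (auto simp: inj_on_def \<alpha>_ghost)
  ultimately show thesis
    using that [of \<alpha>] \<alpha>_closed \<alpha>\<phi> \<alpha>_ghost_unit by blast
qed

text \<open>
  The relation is the kernel of the factor \<open>\<alpha>\<close>. It conserves fibers because \<open>\<alpha>\<close> commutes with passing
  to ghosts and separates ghosts.
\<close>
lemma dominated_cover_is_quotient:
  assumes R: "commutative_semiring R" and v: "m_valuation R M v" and U: "cover R M v U \<phi>"
    and surj: "tangibly_surjective R U \<phi>" and V: "cover R M v V \<psi>"
    and dom: "dominates R U \<phi> V \<psi>"
  shows "\<exists>E \<in> MFC U. ((quotient_semiring U E, quotient_map \<phi> E), (V, \<psi>)) \<in> cover_equiv R M v"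
proof -
  interpret U: supertropical_semiring U using U by (rule supertropical_if_cover)
  interpret V: supertropical_semiring V using V by (rule supertropical_if_cover)
  obtain \<alpha> where closed: "\<alpha> \<in> carrier U \<rightarrow> carrier V"
    and \<alpha>\<phi>: "\<And>a. a \<in> carrier R \<Longrightarrow> \<alpha> (\<phi> a) = \<psi> a"
    and mult: "\<And>x y. \<lbrakk>x \<in> carrier U; y \<in> carrier U\<rbrakk> \<Longrightarrow> \<alpha> (x \<otimes>\<^bsub>U\<^esub> y) = \<alpha> x \<otimes>\<^bsub>V\<^esub> \<alpha> y"
    and ghost: "\<And>x. x \<in> carrier U \<Longrightarrow> \<alpha> (ghost_unit U \<otimes>\<^bsub>U\<^esub> x) = ghost_unit V \<otimes>\<^bsub>V\<^esub> \<alpha> x"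
    and inj: "inj_on \<alpha> (ghost_ideal U)"
    using dominated_cover_factors [OF R v U surj V dom] by blast
  define E where "E = {(x, y). x \<in> carrier U \<and> y \<in> carrier U \<and> \<alpha> x = \<alpha> y}"
  have "equiv (carrier U) E"
    by (rule equivI) (auto simp: E_def refl_on_def sym_def trans_def)
  moreover have "ghost_unit U \<otimes>\<^bsub>U\<^esub> x = ghost_unit U \<otimes>\<^bsub>U\<^esub> y" if "(x, y) \<in> E" for x y
    using that ghost by (intro inj_onD [OF inj]) (auto simp: E_def ghost_ideal_def)
  ultimately have E: "E \<in> MFC U"
    by (auto simp: MFC_def E_def mult)
  note Q = cover_quotient [OF R U E]
  have "quotient_map \<phi> E a = quotient_map \<phi> E b \<longleftrightarrow> \<psi> a = \<psi> b"
    if "a \<in> carrier R" "b \<in> carrier R" for a b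
    unfolding quotient_map_eq_iff [OF U E that]
    using that cover_closed [OF U] by (simp add: E_def \<alpha>\<phi>)
  moreover have "ghost_map (quotient_semiring U E) (quotient_map \<phi> E) a = quotient_map \<phi> E a \<longleftrightarrow>
      ghost_map V \<psi> a = \<psi> a" if "a \<in> carrier R" for a
    unfolding quotient_map_ghost_iff [OF U E that]
    using that cover_closed [OF U that] by (simp add: E_def \<alpha>\<phi> ghost ghost_map_def)
  ultimately have "dominates R (quotient_semiring U E) (quotient_map \<phi> E) V \<psi>"
    and "dominates R V \<psi> (quotient_semiring U E) (quotient_map \<phi> E)"
    by (simp_all add: dominates_covers_iff [OF v Q V] dominates_covers_iff [OF v V Q])
  then show ?thesis
    using E Q V by (auto simp: cover_equiv_def)
qed

section \<open>Classes of covers on a prescribed type\<close>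

definition transported_semiring :: "('u \<Rightarrow> 'w) \<Rightarrow> 'u ring \<Rightarrow> 'w ring" where
  "transported_semiring g U =
     \<lparr>carrier = g ` carrier U,
      mult = (\<lambda>x y. g (inv_into (carrier U) g x \<otimes>\<^bsub>U\<^esub> inv_into (carrier U) g y)),
      one = g \<one>\<^bsub>U\<^esub>,
      zero = g \<zero>\<^bsub>U\<^esub>,
      add = (\<lambda>x y. g (inv_into (carrier U) g x \<oplus>\<^bsub>U\<^esub> inv_into (carrier U) g y))\<rparr>"

lemma transported_fiber_conserving_epi:
  assumes "supertropical_semiring U" and inj: "inj_on g (carrier U)"
  shows "fiber_conserving_epi U (transported_semiring g U) g"
proof -
  interpret supertropical_semiring U by fact
  show ?thesis
  proof unfold_locales
    show "g \<in> ring_hom U (transported_semiring g U)"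
      by (rule ring_hom_memI) (simp_all add: transported_semiring_def inj)
  qed (use inj in \<open>auto simp: transported_semiring_def inj_on_eq_iff\<close>)
qed

text \<open>
  The members of a class have their semirings on the type \<open>'w\<close>. A cover over another type may have
  no equivalent there, and an empty class would carry no information about it; an embedding of
  its semiring into \<open>'w\<close> supplies a representative.
\<close>
lemma cover_class_nonempty:
  fixes g :: "'u \<Rightarrow> 'w"
  assumes R: "commutative_semiring R" and v: "m_valuation R M v" and U: "cover R M v U \<phi>"
    and inj: "inj_on g (carrier U)"
  obtains V :: "'w ring" and \<psi> where "((U, \<phi>), (V, \<psi>)) \<in> cover_equiv R M v"
proof -
  let ?V = "transported_semiring g U"
  interpret fiber_conserving_epi U ?V g
    using supertropical_if_cover [OF U] inj by (rule transported_fiber_conserving_epi)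
  have V: "cover R M v ?V (\<lambda>a. g (\<phi> a))" using R U by (rule cover_image) simp
  note closed = cover_closed [OF U]
  have "g (\<phi> a) = g (\<phi> b) \<longleftrightarrow> \<phi> a = \<phi> b" if "a \<in> carrier R" "b \<in> carrier R" for a b
    using that closed inj by (simp add: inj_on_eq_iff)
  moreover have "ghost_map ?V (\<lambda>a. g (\<phi> a)) a = g (\<phi> a) \<longleftrightarrow> ghost_map U \<phi> a = \<phi> a"
    if "a \<in> carrier R" for a
    using closed [OF that] inj unfolding ghost_map_def
    by (simp add: inj_on_eq_iff flip: hom_ghost_unit_mult del: hom_mult)
  ultimately have "dominates R U \<phi> ?V (\<lambda>a. g (\<phi> a))" "dominates R ?V (\<lambda>a. g (\<phi> a)) U \<phi>"
    by (simp_all add: dominates_covers_iff [OF v U V] dominates_covers_iff [OF v V U])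
  then show thesis
    using U V by (intro that [of ?V "\<lambda>a. g (\<phi> a)"]) (simp add: cover_equiv_def)
qed

lemma quotient_embeds:
  fixes h :: "'u \<Rightarrow> 'w"
  assumes E: "equiv (carrier U) E" and h: "inj_on h (carrier U)"
  shows "inj_on (\<lambda>X. h (SOME x. x \<in> X)) (carrier (quotient_semiring U E))"
proof (rule inj_onI)
  fix X Y
  assume "X \<in> carrier (quotient_semiring U E)" "Y \<in> carrier (quotient_semiring U E)"
    and eq: "h (SOME x. x \<in> X) = h (SOME x. x \<in> Y)"
  then have XY: "X \<in> carrier U // E" "Y \<in> carrier U // E"
    by (simp_all add: quotient_semiring_def)
  have some: "(SOME x. x \<in> Z) \<in> Z \<inter> carrier U" if "Z \<in> carrier U // E" for Z
    using in_quotient_imp_non_empty [OF E that] in_quotient_imp_subset [OF E that]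
    by (metis IntI some_in_eq subsetD)
  then have "(SOME x. x \<in> X) = (SOME x. x \<in> Y)"
    using XY eq h by (auto simp: inj_on_def)
  then show "X = Y"
    using some XY quotient_disj [OF E XY] by (metis Int_iff empty_iff)
qed

lemma cover_equiv_sym:
  "((U, \<phi>), (V, \<psi>)) \<in> cover_equiv R M v \<Longrightarrow> ((V, \<psi>), (U, \<phi>)) \<in> cover_equiv R M v"
  by (auto simp: cover_equiv_def)

lemma cover_equiv_trans:
  "\<lbrakk>((U, \<phi>), (V, \<psi>)) \<in> cover_equiv R M v; ((V, \<psi>), (W, \<chi>)) \<in> cover_equiv R M v\<rbrakk> \<Longrightarrow>
    ((U, \<phi>), (W, \<chi>)) \<in> cover_equiv R M v"
  unfolding cover_equiv_def by (auto intro: dominates_trans)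

lemma cover_class_cong:
  assumes "((U, \<phi>), (V, \<psi>)) \<in> cover_equiv R M v"
  shows "(cover_class R M v U \<phi> :: ('r, 'w) valued_map set) = cover_class R M v V \<psi>"
  using cover_equiv_trans [OF assms] cover_equiv_trans [OF cover_equiv_sym [OF assms]]
  by (auto simp: cover_class_def)

lemma Cov_ge_cover_class_iff:
  fixes f :: "'u \<Rightarrow> 'w" and g :: "'u' \<Rightarrow> 'w"
  assumes R: "commutative_semiring R" and v: "m_valuation R M v"
    and U: "cover R M v U \<phi>" "inj_on f (carrier U)"
    and V: "cover R M v V \<psi>" "inj_on g (carrier V)"
  shows "Cov_ge R (cover_class R M v U \<phi> :: ('r, 'w) valued_map set) (cover_class R M v V \<psi>)
    \<longleftrightarrow> dominates R U \<phi> V \<psi>"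
proof
  assume "Cov_ge R (cover_class R M v U \<phi> :: ('r, 'w) valued_map set) (cover_class R M v V \<psi>)"
  then show "dominates R U \<phi> V \<psi>"
    by (auto simp: Cov_ge_def cover_class_def cover_equiv_def intro: dominates_trans)
next
  assume dom: "dominates R U \<phi> V \<psi>"
  obtain U' :: "'w ring" and \<phi>' where U': "((U, \<phi>), (U', \<phi>')) \<in> cover_equiv R M v"
    using cover_class_nonempty [OF R v U] .
  obtain V' :: "'w ring" and \<psi>' where V': "((V, \<psi>), (V', \<psi>')) \<in> cover_equiv R M v"
    using cover_class_nonempty [OF R v V] .
  have "dominates R U' \<phi>' V' \<psi>'"
    using U' V' dom by (auto simp: cover_equiv_def intro: dominates_trans)
  then show "Cov_ge R (cover_class R M v U \<phi> :: ('r, 'w) valued_map set) (cover_class R M v V \<psi>)"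
    using U' V' by (auto simp: Cov_ge_def cover_class_def)
qed

lemma cover_class_in_Cov:
  fixes g :: "'u \<Rightarrow> 'w"
  assumes "commutative_semiring R" "m_valuation R M v" "cover R M v U \<phi>" "inj_on g (carrier U)"
  shows "(cover_class R M v U \<phi> :: ('r, 'w) valued_map set) \<in> Cov R M v"
proof -
  obtain V :: "'w ring" and \<psi> where V: "((U, \<phi>), (V, \<psi>)) \<in> cover_equiv R M v"
    using cover_class_nonempty [OF assms] .
  then have "cover R M v V \<psi>" by (simp add: cover_equiv_def)
  then show ?thesis
    unfolding cover_class_cong [OF V] Cov_def
    by (auto simp: cover_class_def intro: quotientI)
qed

section \<open>The correspondence\<close>

theorem theorem7p2:
  fixes R :: "'r ring" and M :: "'m ring" and U :: "'u ring"
    and v :: "'r \<Rightarrow> 'm" and \<phi> :: "'r \<Rightarrow> 'u"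
    and h :: "'u \<Rightarrow> 'w"
  assumes "commutative_semiring R"
    and "m_valuation R M v"
    and "cover R M v U \<phi>"
    and "tangibly_surjective R U \<phi>"
    and universe_large_enough: "inj_on h (carrier U)"
  shows "bij_betw (quotient_class R M v U \<phi>)
           (MFC U) (dominated_covers R M v U \<phi> :: ('r, 'w) valued_map set set) \<and>
    anti_isomorphism (quotient_class R M v U \<phi>)
           (MFC U) (\<subseteq>)
           (dominated_covers R M v U \<phi> :: ('r, 'w) valued_map set set) (\<lambda>X Y. Cov_ge R Y X)"
proof -
  let ?Q = "quotient_class R M v U \<phi> :: _ \<Rightarrow> ('r, 'w) valued_map set"
  let ?C = "dominated_covers R M v U \<phi> :: ('r, 'w) valued_map set set"
  note R = assms(1) and v = assms(2) and U = assms(3) and surj = assms(4)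
  interpret supertropical_semiring U using U by (rule supertropical_if_cover)
  note cover = cover_quotient [OF R U]
    and embeds = quotient_embeds [OF MFC_D(1) universe_large_enough]

  have order: "Cov_ge R (?Q E) (?Q F) \<longleftrightarrow> E \<subseteq> F" if E: "E \<in> MFC U" and F: "F \<in> MFC U" for E F
    unfolding quotient_class_def
    using Cov_ge_cover_class_iff [OF R v cover [OF E] embeds [OF E] cover [OF F] embeds [OF F]]
      dominates_quotients_iff [OF R v U surj E F] by simp
  have "inj_on ?Q (MFC U)"
  proof (rule inj_onI)
    fix E F
    assume EF: "E \<in> MFC U" "F \<in> MFC U" and eq: "?Q E = ?Q F"
    have "Cov_ge R (?Q E) (?Q F)" "Cov_ge R (?Q F) (?Q E)"
      using order [OF EF(1) EF(1)] eq by simp_all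
    then show "E = F" using order EF by blast
  qed
  moreover have "?Q E \<in> ?C" if E: "E \<in> MFC U" for E
  proof -
    have "dominates R U \<phi> (quotient_semiring U E) (quotient_map \<phi> E)"
      using dominates_covers_iff [OF v U cover [OF E]] quotient_map_eq_iff [OF U E]
        quotient_map_ghost_iff [OF U E] MFC_D(1) [OF E] cover_closed [OF U]
      by (auto simp: equiv_def refl_on_def)
    then show ?thesis
      using cover_class_in_Cov [OF R v cover [OF E] embeds [OF E]]
        Cov_ge_cover_class_iff [OF R v U universe_large_enough cover [OF E] embeds [OF E]]
      by (simp add: dominated_covers_def quotient_class_def)
  qed
  moreover have "X \<in> ?Q ` MFC U" if X: "X \<in> ?C" for X
  proof -
    obtain V :: "'w ring" and \<psi> where V: "cover R M v V \<psi>" and X_eq: "X = cover_class R M v V \<psi>"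
      using X by (auto simp: dominated_covers_def Cov_def cover_class_def elim!: quotientE)
    have "dominates R U \<phi> V \<psi>"
      using X Cov_ge_cover_class_iff [OF R v U universe_large_enough V inj_on_id]
      by (simp add: dominated_covers_def X_eq)
    then obtain E where E: "E \<in> MFC U"
      and "((quotient_semiring U E, quotient_map \<phi> E), (V, \<psi>)) \<in> cover_equiv R M v"
      using dominated_cover_is_quotient [OF R v U surj V] by blast
    then have "X = ?Q E"
      unfolding X_eq quotient_class_def by (simp add: cover_class_cong)
    with E show ?thesis by blast
  qed
  ultimately have "bij_betw ?Q (MFC U) ?C"
    by (auto simp: bij_betw_def)
  then show ?thesis
    using order by (simp add: anti_isomorphism_def)
qed

end
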